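(* Let $\lambda>-1/2$ and let $n\ge 1$ be an integer. Let $\mathcal{P}_n$ be the set of algebraic polynomials of degree at most $n$, let $$\|f\|:=\Big(\int_{-1}^{1}(1-t^2)^{\lambda-1/2}\,|f(t)|^2\,dt\Big)^{1/2},$$ and let $$c_{n,\lambda}:=\sup_{f\in\mathcal{P}_n,\ f\neq 0}\frac{\|f'\|}{\|f\|}$$ be the sharp constant in the Markov inequality $\|f'\|\le c\,\|f\|$, $f\in\mathcal{P}_n$. Then $$c_{n,\lambda}<\frac{(n+1)(n+2\lambda+1)}{2\sqrt{2\lambda+1}}.$$
   Context: Polynomials are taken with complex coefficients. *)

theory Defs
  imports "HOL-Analysis.Analysis" "HOL-Computational_Algebra.Polynomial"
begin

text \<open>The weighted $L_2$ norm on $[-1,1]$ with the Gegenbauer weight. At the endpoints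
  \<open>0 powr a = 0\<close>, also for \<open>a \<le> 0\<close>; this only concerns a null set. For \<open>lam > -1/2\<close> the weight
  is integrable, so for polynomials the Bochner integral is never the default value \<open>0\<close> of a
  non-integrable function.\<close>

definition gegenbauer_norm :: "real \<Rightarrow> complex poly \<Rightarrow> real" where
  "gegenbauer_norm lam f =
     sqrt (LBINT t:{-1..1}. (1 - t\<^sup>2) powr (lam - 1/2) * (cmod (poly f (complex_of_real t)))\<^sup>2)"

text \<open>The supremum is taken in the extended reals, so that it is the true supremum without a prior
  boundedness proof; a finite upper bound on it includes the finiteness of the constant.\<close>

definition markov_const :: "nat \<Rightarrow> real \<Rightarrow> ereal" where
  "markov_const n lam =
     (SUP f\<in>{f :: complex poly. degree f \<le> n \<and> f \<noteq> 0}.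
        ereal (gegenbauer_norm lam (pderiv f) / gegenbauer_norm lam f))"

end

theory Submission
  imports Defs
begin

text \<open>Write $L(q) = \int_{-1}^1 (1-t^2)^{\lambda-1/2} q(t)\,dt$. Integration by parts gives
  $L((1-t^2)q') = (2\lambda+1) L(t q)$, so the operator $y \mapsto (1-t^2)y'' - (2\lambda+1)ty'$ is
  symmetric for $L$. It has an eigenpolynomial $y_k$ of each degree $k$, with eigenvalue
  $-k(k+2\lambda)$ and parity $k$, and these are orthogonal. From the differential equation,
  $L(y_k'^2) = \frac{2k(k+\lambda)(k+2\lambda)}{2\lambda+1} L(y_k^2)$.

  Differentiation maps even polynomials to odd ones and vice versa, so it suffices to bound it on each
  parity class. There its Hilbert--Schmidt norm is bounded by summing the last formula over the
  $k \le n$ of one parity; that the sum stays below the square of the claimed constant follows by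
  induction in steps of two. A complex polynomial is split into its real and imaginary parts.\<close>

section \<open>The weighted integral as a positive linear functional on real polynomials\<close>

definition gegenbauer_int :: "real \<Rightarrow> real poly \<Rightarrow> real" where
  "gegenbauer_int lam q = (LBINT t:{-1..1}. (1 - t\<^sup>2) powr (lam - 1/2) * poly q t)"

text \<open>Under t = 2x - 1 the weight becomes \<open>4 powr (lam - 1/2)\<close> times the Beta
  integrand with both parameters \<open>lam + 1/2\<close>, which are positive.\<close>

lemma gegenbauer_weight_absolutely_integrable:
  fixes lam :: real
  assumes "lam > -1/2"
  shows "(\<lambda>t. (1 - t\<^sup>2) powr (lam - 1/2)) absolutely_integrable_on {-1..1::real}"
proof (rule nonnegative_absolutely_integrable_1)
  let ?b = "\<lambda>t::real. t powr (lam - 1/2) * (1 - t) powr (lam - 1/2)"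
  have "(?b has_integral Beta (lam + 1/2) (lam + 1/2)) (cbox 0 1)"
    using has_integral_Beta_real[of "lam + 1/2" "lam + 1/2"] assms by (simp add: field_simps)
  from has_integral_affinity[OF this, of "1/2" "1/2"]
  have "((\<lambda>t. ?b (1/2 * t + 1/2)) has_integral 2 * Beta (lam + 1/2) (lam + 1/2))
      ((\<lambda>t. 2 * t + - 1) ` {0..1})"
    by simp
  moreover have "(\<lambda>t. 2 * t + - 1) ` {0..1} = {-1..1::real}"
    by (subst image_affinity_atLeastAtMost) auto
  ultimately have "(\<lambda>t. ?b (1/2 * t + 1/2)) integrable_on {-1..1}"
    by (auto simp: integrable_on_def)
  then have "(\<lambda>t. 4 powr (lam - 1/2) * ?b (1/2 * t + 1/2)) integrable_on {-1..1}"
    by (rule integrable_on_mult_right)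
  then show "(\<lambda>t::real. (1 - t\<^sup>2) powr (lam - 1/2)) integrable_on {-1..1}"
  proof (rule integrable_eq)
    fix t :: real assume "t \<in> {-1..1}"
    then have "4 powr (lam - 1/2) * ?b (1/2 * t + 1/2)
        = (4 * ((1/2 * t + 1/2) * (1 - (1/2 * t + 1/2)))) powr (lam - 1/2)"
      by (simp add: powr_mult)
    also have "4 * ((1/2 * t + 1/2) * (1 - (1/2 * t + 1/2))) = 1 - t\<^sup>2"
      by (simp add: field_simps power2_eq_square)
    finally show "4 powr (lam - 1/2) * ?b (1/2 * t + 1/2) = (1 - t\<^sup>2) powr (lam - 1/2)" .
  qed
qed auto

lemma gegenbauer_set_integrable:
  fixes lam :: real and q :: "real poly"
  assumes "lam > -1/2"
  shows "set_integrable lborel {-1..1} (\<lambda>t. (1 - t\<^sup>2) powr (lam - 1/2) * poly q t)"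
proof -
  have cont: "continuous_on A (poly q)" for A
    using continuous_on_poly[of A "\<lambda>t. t" q] by simp
  then have [measurable]: "poly q \<in> borel_measurable borel"
    by (rule borel_measurable_continuous_onI)
  have "(\<lambda>t. poly q t * (1 - t\<^sup>2) powr (lam - 1/2)) absolutely_integrable_on {-1..1}"
  proof (rule absolutely_integrable_bounded_measurable_product_real)
    show "poly q \<in> borel_measurable (lebesgue_on {-1..1})"
      using cont by (rule continuous_imp_measurable_on_sets_lebesgue) auto
    show "bounded (poly q ` {-1..1})"
      using cont by (intro compact_imp_bounded compact_continuous_image) auto
  qed (auto intro: gegenbauer_weight_absolutely_integrable assms)
  \<comment> \<open>Absolute integrability refers to the completed measure; the integrand is Borel
    measurable, so integrability carries over to \<open>lborel\<close>.\<close>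
  then show ?thesis
    unfolding set_integrable_def
    by (subst (asm) integrable_completion) (auto simp: mult.commute)
qed

locale gegenbauer =
  fixes lam :: real
  assumes lam: "lam > -1/2"
begin

abbreviation L :: "real poly \<Rightarrow> real" where "L \<equiv> gegenbauer_int lam"

lemmas set_integrable = gegenbauer_set_integrable[OF lam]

lemma L_add: "L (p + q) = L p + L q"
  unfolding gegenbauer_int_def
  by (simp add: ring_distribs set_integral_add set_integrable)

lemma L_smult: "L (smult c p) = c * L p"
  unfolding gegenbauer_int_def
  by (simp add: mult.left_commute)

lemma L_0 [simp]: "L 0 = 0"
  using L_smult[of 0 0] by simp

lemma L_minus: "L (- p) = - L p"
  using L_smult[of "-1" p] by simp

lemma L_diff: "L (p - q) = L p - L q"
  using L_add[of p "- q"] by (simp add: L_minus)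

lemma L_sum: "L (\<Sum>i\<in>I. g i) = (\<Sum>i\<in>I. L (g i))"
  by (induction I rule: infinite_finite_induct) (auto simp: L_add)

lemma L_mono:
  assumes "\<And>x. poly p x \<le> poly q x"
  shows "L p \<le> L q"
  unfolding gegenbauer_int_def
  by (rule set_integral_mono) (auto intro!: set_integrable mult_left_mono assms)

text \<open>A nonnegative integrand with integral 0 vanishes almost everywhere. On the open interval
  the weight is positive and \<open>p\<close> has finitely many roots, so that interval would be a
  null set.\<close>

lemma L_square_pos:
  assumes "p \<noteq> 0"
  shows "L (p * p) > 0"
proof -
  let ?g = "\<lambda>t. indicator {-1..1} t * ((1 - t\<^sup>2) powr (lam - 1/2) * poly (p * p) t) :: real"
  have nn: "?g t \<ge> 0" for t by simp
  have "L (p * p) = integral\<^sup>L lborel ?g"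
    by (simp add: gegenbauer_int_def set_lebesgue_integral_def)
  moreover have "integral\<^sup>L lborel ?g \<noteq> 0"
  proof
    assume "integral\<^sup>L lborel ?g = 0"
    then have "AE t in lborel. ?g t = 0"
      using set_integrable[of "p * p"] nn unfolding set_integrable_def
      by (subst (asm) integral_nonneg_eq_0_iff_AE) auto
    moreover have "AE t in lborel. t \<notin> {t. poly p t = 0}"
      using poly_roots_finite[OF assms] by (intro AE_not_in finite_imp_null_set_lborel)
    ultimately have "AE t in lborel. t \<notin> {-1<..<1::real}"
    proof eventually_elim
      case (elim t)
      show ?case
      proof
        assume t: "t \<in> {-1<..<1}"
        then have "t\<^sup>2 < 1" by (simp add: abs_square_less_1 abs_less_iff)
        then show False using elim t by (auto simp: indicator_def)
      qed
    qed
    then have "{-1<..<1::real} \<in> null_sets lborel"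
      by (subst AE_iff_null_sets) auto
    then show False by (simp add: null_sets_def)
  qed
  ultimately show ?thesis
    using Bochner_Integration.integral_nonneg[of lborel ?g, OF nn] by linarith
qed

text \<open>The fundamental theorem for \<open>(1 - t\<^sup>2) powr (lam + 1/2) * poly q t\<close>:
  since the exponent is positive, this is continuous up to the endpoints and vanishes there, while
  its derivative is only taken in the interior.\<close>

lemma L_by_parts: "L ([:1, 0, -1:] * pderiv q) = (2 * lam + 1) * L ([:0, 1:] * q)"
proof -
  let ?w = "\<lambda>t::real. (1 - t\<^sup>2) powr (lam - 1/2)"
  let ?r = "[:1, 0, -1:] * pderiv q - smult (2 * lam + 1) ([:0, 1:] * q)"
  let ?F = "\<lambda>t. (1 - t\<^sup>2) powr (lam + 1/2) * poly q t"
  have "((\<lambda>t. ?w t * poly ?r t) has_integral ?F 1 - ?F (-1)) {-1..1}"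
  proof (rule fundamental_theorem_of_calculus_interior)
    show "continuous_on {-1..1} ?F"
      using lam by (intro continuous_on_mult continuous_on_powr' continuous_on_poly continuous_intros)
        (auto simp: abs_square_le_1 abs_le_iff)
  next
    fix t :: real assume "t \<in> {-1<..<1}"
    then have t: "1 - t\<^sup>2 > 0" by (simp add: abs_square_less_1 abs_less_iff)
    have e: "(1 - t\<^sup>2) powr (lam + 1/2) = ?w t * (1 - t\<^sup>2)"
      using t powr_add[of "1 - t\<^sup>2" "lam - 1/2" 1] by (simp add: add.commute)
    have "(?F has_real_derivative ((lam + 1/2) * ?w t * (- 2 * t)) * poly q t
        + (1 - t\<^sup>2) powr (lam + 1/2) * poly (pderiv q) t) (at t)"
      using t by (auto intro!: derivative_eq_intros simp: algebra_simps)
    then show "(?F has_vector_derivative ?w t * poly ?r t) (at t)"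
      unfolding e has_real_derivative_iff_has_vector_derivative
      by (rule has_vector_derivative_eq_rhs) (simp add: algebra_simps power2_eq_square)
  qed auto
  then have "L ?r = 0"
    unfolding gegenbauer_int_def
    by (subst set_borel_integral_eq_integral(2)[OF set_integrable]) (auto simp: integral_unique)
  then show ?thesis
    by (simp only: L_diff L_smult)
qed


end

section \<open>Even and odd polynomials\<close>

text \<open>Only the parity of \<open>s\<close> matters; a natural number lets products add the
  indices and differentiation add one. The zero polynomial has both parities.\<close>

definition parity_poly :: "nat \<Rightarrow> 'a::zero poly \<Rightarrow> bool" where
  "parity_poly s p \<longleftrightarrow> (\<forall>i. coeff p i \<noteq> 0 \<longrightarrow> even (i + s))"

lemma parity_poly_mult:
  assumes "parity_poly s p" "parity_poly r q"
  shows "parity_poly (s + r) (p * q)"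
  unfolding parity_poly_def
proof (intro allI impI)
  fix i assume "coeff (p * q) i \<noteq> 0"
  then obtain j where "j \<le> i" "coeff p j * coeff q (i - j) \<noteq> 0"
    unfolding coeff_mult by (meson atMost_iff sum.not_neutral_contains_not_neutral)
  then have "coeff p j \<noteq> 0" "coeff q (i - j) \<noteq> 0" "i = j + (i - j)"
    using mult_not_zero by auto
  then have "even (j + s)" "even (i - j + r)" "i = j + (i - j)"
    using assms unfolding parity_poly_def by blast+
  then show "even (i + (s + r))"
    by (metis add.assoc add.left_commute even_add)
qed

lemma parity_poly_add:
  fixes p q :: "'a::comm_monoid_add poly"
  assumes "parity_poly s p" "parity_poly s q"
  shows "parity_poly s (p + q)"
  unfolding parity_poly_def
proof (intro allI impI)
  fix i assume "coeff (p + q) i \<noteq> 0"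
  then have "coeff p i \<noteq> 0 \<or> coeff q i \<noteq> 0" by auto
  then show "even (i + s)"
    using assms unfolding parity_poly_def by blast
qed

lemma parity_poly_sum:
  fixes f :: "'b \<Rightarrow> 'a::comm_monoid_add poly"
  assumes "\<And>k. k \<in> I \<Longrightarrow> parity_poly s (f k)"
  shows "parity_poly s (\<Sum>k\<in>I. f k)"
  using assms
proof (induction I rule: infinite_finite_induct)
  case (insert k I)
  then show ?case by (simp add: parity_poly_add)
qed (auto simp: parity_poly_def)

lemma parity_poly_pderiv: "parity_poly s p \<Longrightarrow> parity_poly (Suc s) (pderiv p)"
  by (fastforce simp: parity_poly_def coeff_pderiv)

context gegenbauer
begin

text \<open>For the moments m_i of the weight, integration by parts with t^(i-1) gives (i + 2 lam)
  m_i = (i - 1) m_(i-2), so odd moments vanish by induction.\<close>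

lemma L_monom_odd: "odd i \<Longrightarrow> L (monom c i) = 0"
proof (induction i arbitrary: c rule: less_induct)
  case (less i)
  have *: "[:1, 0, -1:] * pderiv (monom c (i - 1))
      = monom (real (i - 1) * c) (i - 2) - monom (real (i - 1) * c) i"
    and **: "[:0, 1:] * monom c (i - 1) = monom c i"
    using \<open>odd i\<close>
    by (auto simp: poly_eq_iff coeff_pderiv coeff_pCons odd_pos split: nat.split elim!: oddE)
  have IH: "L (monom (real (i - 1) * c) (i - 2)) = 0"
  \<comment> \<open>For \<open>i = 1\<close> the truncated index \<open>i - 2\<close> is 0, which is
    even, but the coefficient \<open>real (i - 1)\<close> is 0.\<close>
  proof (cases "i = 1")
    case False
    with \<open>odd i\<close> have "i - 2 < i" "odd (i - 2)" by (auto elim!: oddE)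
    then show ?thesis by (rule less.IH)
  qed simp
  have "monom (real (i - 1) * c) i = smult (real (i - 1)) (monom c i)"
    by (simp add: smult_monom)
  with L_by_parts[of "monom c (i - 1)"] IH
  have "- real (i - 1) * L (monom c i) = (2 * lam + 1) * L (monom c i)"
    unfolding * ** by (simp only: L_diff L_smult)
  then have "(real (i - 1) + 2 * lam + 1) * L (monom c i) = 0"
    by (simp only: ring_distribs)
  moreover have "real (i - 1) + 2 * lam + 1 > 0"
    using lam by linarith
  ultimately show ?case by simp
qed

lemma L_odd:
  assumes "parity_poly s p" "odd s"
  shows "L p = 0"
proof -
  have "L p = (\<Sum>i\<le>degree p. L (monom (coeff p i) i))"
    by (subst poly_as_sum_of_monoms[of p, symmetric]) (rule L_sum)
  also have "\<dots> = 0"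
  proof (rule sum.neutral, rule ballI)
    fix i
    show "L (monom (coeff p i) i) = 0"
      using assms L_monom_odd by (cases "coeff p i = 0") (auto simp: parity_poly_def)
  qed
  finally show ?thesis .
qed

section \<open>The Gegenbauer differential operator and its eigenpolynomials\<close>

definition diff_op :: "real poly \<Rightarrow> real poly" where
  "diff_op p = [:1, 0, -1:] * pderiv (pderiv p) - smult (2 * lam + 1) ([:0, 1:] * pderiv p)"

text \<open>Sign convention: the eigenvalues of \<open>diff_op\<close> are
  \<open>- eigval k\<close>.\<close>

definition eigval :: "nat \<Rightarrow> real" where
  "eigval k = real k * (real k + 2 * lam)"

text \<open>In the monomial basis the operator is triangular with diagonal entries
  \<open>- eigval i\<close> and shifts indices by 0 or 2 only. Hence equations are solvable from the
  top coefficient down, within one parity class.\<close>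

lemma coeff_diff_op: "coeff (diff_op p) i = real (i + 2) * real (i + 1) * coeff p (i + 2) - eigval i * coeff p i"
proof (cases i)
  case (Suc j)
  then show ?thesis
    by (cases j) (simp_all add: diff_op_def eigval_def coeff_pderiv algebra_simps)
qed (simp add: diff_op_def eigval_def coeff_pderiv)

text \<open>The product rule splits off the terms of \<open>L_by_parts\<close> for
  \<open>pderiv p * q\<close>, which cancel. The right-hand side is symmetric in \<open>p\<close>
  and \<open>q\<close>, whence the symmetry of the operator.\<close>

lemma L_diff_op: "L (diff_op p * q) = - L ([:1, 0, -1:] * (pderiv p * pderiv q))"
proof -
  have "diff_op p * q = [:1, 0, -1:] * pderiv (pderiv p * q)
      - smult (2 * lam + 1) ([:0, 1:] * (pderiv p * q)) - [:1, 0, -1:] * (pderiv p * pderiv q)"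
    by (simp only: diff_op_def pderiv_mult ring_distribs mult_smult_left mult.assoc) (simp add: mult_ac)
  then show ?thesis
    by (simp only: L_diff L_smult L_by_parts)
qed

lemma L_diff_op_commute: "L (diff_op p * q) = L (p * diff_op q)"
  using L_diff_op[of p q] L_diff_op[of q p] by (simp add: mult_ac)

lemma eigval_strict_mono:
  assumes "i < k"
  shows "eigval i < eigval k"
proof -
  have "eigval k - eigval i = (real k - real i) * (real k + real i + 2 * lam)"
    by (simp add: eigval_def algebra_simps)
  moreover have "real k \<ge> real i + 1" using assms by linarith
  then have "(real k - real i) * (real k + real i + 2 * lam) > 0"
    using lam by (intro mult_pos_pos) auto
  ultimately show ?thesis by simp
qed

text \<open>Back substitution in a triangular system: the diagonal entries
  \<open>\<mu> - eigval i\<close> are nonzero for the indices below \<open>k\<close>.\<close>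

lemma diff_op_resolvent:
  assumes "\<And>i. i \<ge> k \<Longrightarrow> coeff g i = 0" "parity_poly s g" "\<And>i. i < k \<Longrightarrow> eigval i \<noteq> \<mu>"
  shows "\<exists>h. (\<forall>i\<ge>k. coeff h i = 0) \<and> parity_poly s h \<and> diff_op h + smult \<mu> h = g"
  using assms
proof (induction k arbitrary: g)
  case 0
  then have "g = 0" by (simp add: poly_eq_iff)
  then show ?case by (intro exI[of _ 0]) (simp add: diff_op_def parity_poly_def)
next
  case (Suc k)
  \<comment> \<open>The monomial that produces the top coefficient of \<open>g\<close>; what remains
    has all coefficients from \<open>k\<close> on equal to 0.\<close>
  define c where "c = coeff g k / (\<mu> - eigval k)"
  define h where "h = monom c k"
  have c: "c * (\<mu> - eigval k) = coeff g k"
    using Suc.prems(3)[of k] by (simp add: c_def)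
  have h: "parity_poly s h"
    using Suc.prems(2) by (auto simp: parity_poly_def h_def c_def)
  have "\<exists>h'. (\<forall>i\<ge>k. coeff h' i = 0) \<and> parity_poly s h' \<and> diff_op h' + smult \<mu> h' = g - (diff_op h + smult \<mu> h)"
  proof (rule Suc.IH)
    fix i assume "i \<ge> k"
    then show "coeff (g - (diff_op h + smult \<mu> h)) i = 0"
      using Suc.prems(1)[of i] c by (cases "i = k") (auto simp: coeff_diff_op h_def algebra_simps)
  next
    show "parity_poly s (g - (diff_op h + smult \<mu> h))"
      unfolding parity_poly_def
    proof (intro allI impI)
      fix i assume "coeff (g - (diff_op h + smult \<mu> h)) i \<noteq> 0"
      then have "coeff g i \<noteq> 0 \<or> coeff h i \<noteq> 0 \<or> coeff h (i + 2) \<noteq> 0"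
        by (auto simp: coeff_diff_op)
      then show "even (i + s)"
        using h Suc.prems(2) unfolding parity_poly_def by (metis add.commute even_add even_numeral)
    qed
  qed (use Suc.prems(3) in auto)
  then obtain h' where h': "\<forall>i\<ge>k. coeff h' i = 0" "parity_poly s h'"
      "diff_op h' + smult \<mu> h' = g - (diff_op h + smult \<mu> h)"
    by blast
  show ?case
  proof (intro exI conjI allI impI)
    show "coeff (h + h') i = 0" if "i \<ge> Suc k" for i
      using h'(1) that by (auto simp: h_def)
    show "parity_poly s (h + h')"
      using h h'(2) by (rule parity_poly_add)
    show "diff_op (h + h') + smult \<mu> (h + h') = g"
      using h'(3) by (simp add: diff_op_def pderiv_add algebra_simps smult_add_right)
  qed
qed

text \<open>Applying \<open>diff_op + eigval k\<close> to t^k cancels the top term. The residue of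
  lower degree is the image of some \<open>h\<close> of lower degree, as the smaller eigenvalues
  differ from \<open>eigval k\<close>; t^k - \<open>h\<close> is the eigenpolynomial.\<close>

lemma eigenpoly_exists:
  "\<exists>p. coeff p k = 1 \<and> (\<forall>i>k. coeff p i = 0) \<and> parity_poly k p \<and> diff_op p = smult (- eigval k) p"
proof -
  let ?g = "diff_op (monom 1 k) + smult (eigval k) (monom 1 k)"
  have "\<exists>h. (\<forall>i\<ge>k. coeff h i = 0) \<and> parity_poly k h \<and> diff_op h + smult (eigval k) h = ?g"
  proof (rule diff_op_resolvent)
    show "parity_poly k ?g"
      by (auto simp: parity_poly_def coeff_diff_op split: if_splits)
    show "coeff ?g i = 0" if "i \<ge> k" for i
      using that by (auto simp: coeff_diff_op)
    show "eigval i \<noteq> eigval k" if "i < k" for i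
      using eigval_strict_mono[OF that] by simp
  qed
  then obtain h where h: "\<forall>i\<ge>k. coeff h i = 0" "parity_poly k h" "diff_op h + smult (eigval k) h = ?g"
    by blast
  show ?thesis
  proof (intro exI conjI allI impI)
    show "coeff (monom 1 k - h) k = 1" using h(1) by simp
    show "coeff (monom 1 k - h) i = 0" if "i > k" for i using h(1) that by simp
    show "parity_poly k (monom 1 k - h)"
      using h(2) by (auto simp: parity_poly_def split: if_splits)
    have "diff_op (monom 1 k - h) = diff_op (monom 1 k) - diff_op h"
      by (simp add: diff_op_def pderiv_diff algebra_simps smult_diff_right)
    also have "\<dots> = smult (- eigval k) (monom 1 k - h)"
      using h(3) by (simp add: smult_diff_right algebra_simps)
    finally show "diff_op (monom 1 k - h) = smult (- eigval k) (monom 1 k - h)" .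
  qed
qed

text \<open>The monic Gegenbauer polynomial, for \<open>lam = 0\<close> the monic Chebyshev
  polynomial of the first kind.\<close>

definition eigenpoly :: "nat \<Rightarrow> real poly" where
  "eigenpoly k = (SOME p. coeff p k = 1 \<and> (\<forall>i>k. coeff p i = 0) \<and> parity_poly k p \<and> diff_op p = smult (- eigval k) p)"

lemma
  shows coeff_eigenpoly_top: "coeff (eigenpoly k) k = 1"
    and coeff_eigenpoly_above: "i > k \<Longrightarrow> coeff (eigenpoly k) i = 0"
    and parity_eigenpoly: "parity_poly k (eigenpoly k)"
    and diff_op_eigenpoly: "diff_op (eigenpoly k) = smult (- eigval k) (eigenpoly k)"
  using someI_ex[OF eigenpoly_exists[of k]] unfolding eigenpoly_def by blast+

lemma eigenpoly_nonzero: "eigenpoly k \<noteq> 0"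
  using coeff_eigenpoly_top[of k] by auto

lemma eigenpoly_orthogonal:
  assumes "j \<noteq> k"
  shows "L (eigenpoly j * eigenpoly k) = 0"
proof -
  have "eigval j * L (eigenpoly j * eigenpoly k) = eigval k * L (eigenpoly j * eigenpoly k)"
    using L_diff_op_commute[of "eigenpoly j" "eigenpoly k"] by (simp add: diff_op_eigenpoly L_smult L_minus)
  moreover have "eigval j \<noteq> eigval k"
    using assms eigval_strict_mono[of j k] eigval_strict_mono[of k j] by (cases j k rule: linorder_cases) auto
  ultimately show ?thesis by simp
qed

lemma eigenpoly_expansion:
  assumes "\<And>i. i \<ge> k \<Longrightarrow> coeff q i = 0"
  shows "\<exists>a. q = (\<Sum>j<k. smult (a j) (eigenpoly j))"
  using assms
proof (induction k arbitrary: q)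
  case 0
  then show ?case by (simp add: poly_eq_iff)
next
  case (Suc k)
  have "coeff (q - smult (coeff q k) (eigenpoly k)) i = 0" if "i \<ge> k" for i
    using that Suc.prems[of i] by (cases "i = k") (auto simp: coeff_eigenpoly_top coeff_eigenpoly_above)
  then obtain a where a: "q - smult (coeff q k) (eigenpoly k) = (\<Sum>j<k. smult (a j) (eigenpoly j))"
    using Suc.IH by blast
  have "(\<Sum>j<k. smult ((a(k := coeff q k)) j) (eigenpoly j)) = (\<Sum>j<k. smult (a j) (eigenpoly j))"
    by (rule sum.cong) auto
  then have "q = (\<Sum>j<Suc k. smult ((a(k := coeff q k)) j) (eigenpoly j))"
    using a by (simp add: algebra_simps)
  then show ?case by blast
qed

lemma eigenpoly_orthogonal_lower:
  assumes "\<And>i. i \<ge> k \<Longrightarrow> coeff q i = 0"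
  shows "L (eigenpoly k * q) = 0"
proof -
  obtain a where "q = (\<Sum>j<k. smult (a j) (eigenpoly j))"
    using eigenpoly_expansion[OF assms] by blast
  then show ?thesis
    by (simp add: sum_distrib_left L_sum L_smult eigenpoly_orthogonal)
qed

text \<open>Split 1 = (1 - t^2) + t^2. The first part comes from \<open>L_diff_op\<close>. For the
  second, integrate t y'^2 by parts and replace (1 - t^2) y'' by the differential equation; this
  yields a linear equation for \<open>X\<close>.\<close>

lemma L_pderiv_eigenpoly_square:
  "L (pderiv (eigenpoly k) * pderiv (eigenpoly k)) = 2 * eigval k * (real k + lam) / (2 * lam + 1) * L (eigenpoly k * eigenpoly k)"
proof -
  let ?y = "eigenpoly k" and ?d = "pderiv (eigenpoly k)" and ?w = "[:1, 0, -1:] :: real poly" and ?t = "[:0, 1:] :: real poly"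
  define N X where "N = L (?y * ?y)" and "X = L (?t * (?t * (?d * ?d)))"
  have 1: "L (?w * (?d * ?d)) = eigval k * N"
    using L_diff_op[of ?y ?y] by (simp add: diff_op_eigenpoly L_smult L_minus N_def)
  \<comment> \<open>Both t y' and k y have leading coefficient k, so their difference has lower
    degree and is orthogonal to y.\<close>
  have "coeff (?t * ?d - smult (real k) ?y) i = 0" if "i \<ge> k" for i
    using that by (cases i) (auto simp: coeff_pderiv coeff_eigenpoly_above coeff_eigenpoly_top le_less)
  then have "L (?y * (?t * ?d - smult (real k) ?y)) = 0"
    by (rule eigenpoly_orthogonal_lower)
  then have 2: "L (?y * (?t * ?d)) = real k * N"
    by (simp only: right_diff_distrib L_diff mult_smult_right L_smult N_def)
  have w: "?w * pderiv ?d = smult (2 * lam + 1) (?t * ?d) - smult (eigval k) ?y"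
    using diff_op_eigenpoly[of k] unfolding diff_op_def by (simp add: algebra_simps)
  have "?w * pderiv (?t * (?d * ?d)) = ?w * (?d * ?d) + smult 2 ((?t * ?d) * (?w * pderiv ?d))"
  proof -
    have t: "pderiv ?t = 1" by (simp add: pderiv_pCons)
    have s: "smult 2 r = r + r" for r :: "real poly"
      by (rule poly_eqI) (simp only: coeff_smult coeff_add mult_2)
    show ?thesis
      unfolding pderiv_mult t s by (simp only: ring_distribs mult_ac mult_1)
  qed
  also have "\<dots> = ?w * (?d * ?d) + smult 2 (smult (2 * lam + 1) (?t * (?t * (?d * ?d)))
      - smult (eigval k) (?y * (?t * ?d)))"
    unfolding w by (simp only: right_diff_distrib mult_smult_right mult_ac)
  finally have "(2 * lam + 1) * X = eigval k * N + 2 * ((2 * lam + 1) * X - eigval k * (real k * N))"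
    using L_by_parts[of "?t * (?d * ?d)"] by (simp only: L_add L_smult L_diff 1 2 X_def)
  moreover have "2 * lam + 1 > 0" using lam by simp
  ultimately have X: "X = eigval k * (2 * real k - 1) / (2 * lam + 1) * N"
    by (simp add: field_simps)
  have "?d * ?d = ?w * (?d * ?d) + ?t * (?t * (?d * ?d))"
    by (simp add: algebra_simps)
  then have "L (?d * ?d) = eigval k * N + X"
    using 1 L_add X_def by metis
  also have "\<dots> = 2 * eigval k * (real k + lam) / (2 * lam + 1) * N"
    using \<open>2 * lam + 1 > 0\<close> unfolding X by (simp add: field_simps)
  finally show ?thesis by (simp add: N_def)
qed


section \<open>The Hilbert-Schmidt bound and the estimate of the traces\<close>

text \<open>Pointwise Cauchy-Schwarz for the expansion of \<open>pderiv f\<close> in the derivatives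
  of the normalised eigenpolynomials, then integration. The constant is the squared Hilbert-Schmidt
  norm of differentiation on their span.\<close>

lemma pderiv_bound_from_trace:
  assumes "finite I" and f: "f = (\<Sum>k\<in>I. smult (a k) (eigenpoly k))"
  shows "L (pderiv f * pderiv f)
    \<le> (\<Sum>k\<in>I. 2 * eigval k * (real k + lam) / (2 * lam + 1)) * L (f * f)"
proof -
  define h where "h k = L (eigenpoly k * eigenpoly k)" for k
  have h: "h k > 0" for k
    unfolding h_def by (rule L_square_pos[OF eigenpoly_nonzero])
  have "L (f * f) = (\<Sum>j\<in>I. \<Sum>k\<in>I. a j * a k * L (eigenpoly j * eigenpoly k))"
    unfolding f by (simp add: sum_product L_sum L_smult mult_ac)
  also have "\<dots> = (\<Sum>j\<in>I. \<Sum>k\<in>I. if j = k then (a k)\<^sup>2 * h k else 0)"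
    by (intro sum.cong refl) (auto simp: eigenpoly_orthogonal h_def power2_eq_square)
  also have "\<dots> = (\<Sum>k\<in>I. (a k)\<^sup>2 * h k)"
    using assms(1) by simp
  finally have norm_f: "L (f * f) = (\<Sum>k\<in>I. (a k)\<^sup>2 * h k)" .
  have "L (pderiv f * pderiv f)
      \<le> L (smult (L (f * f)) (\<Sum>k\<in>I. smult (1 / h k) (pderiv (eigenpoly k) * pderiv (eigenpoly k))))"
  proof (rule L_mono)
    fix x
    \<comment> \<open>The factors \<open>sqrt (h k)\<close> normalise the basis, so that the squared
      coefficients add up to \<open>L (f * f)\<close>.\<close>
    have "poly (pderiv f) x = (\<Sum>k\<in>I. (a k * sqrt (h k)) * (poly (pderiv (eigenpoly k)) x / sqrt (h k)))"
      unfolding f higher_pderiv_sum[of 1, simplified] poly_sum by (rule sum.cong) (simp_all add: pderiv_smult h less_imp_neq[OF h, symmetric])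
    then have "poly (pderiv f * pderiv f) x
        = (\<Sum>k\<in>I. (a k * sqrt (h k)) * (poly (pderiv (eigenpoly k)) x / sqrt (h k)))\<^sup>2"
      by (simp add: power2_eq_square)
    also have "\<dots> \<le> (\<Sum>k\<in>I. (a k * sqrt (h k))\<^sup>2) * (\<Sum>k\<in>I. (poly (pderiv (eigenpoly k)) x / sqrt (h k))\<^sup>2)"
      by (rule Cauchy_Schwarz_ineq_sum)
    also have "\<dots> = poly (smult (L (f * f)) (\<Sum>k\<in>I. smult (1 / h k) (pderiv (eigenpoly k) * pderiv (eigenpoly k)))) x"
      using h less_imp_le[OF h]
      by (simp add: norm_f poly_sum power_mult_distrib power_divide)
         (simp add: power2_eq_square)
    finally show "poly (pderiv f * pderiv f) x \<le> \<dots>" .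
  qed
  also have "\<dots> = L (f * f) * (\<Sum>k\<in>I. L (pderiv (eigenpoly k) * pderiv (eigenpoly k)) / h k)"
    by (simp add: L_smult L_sum)
  also have "(\<Sum>k\<in>I. L (pderiv (eigenpoly k) * pderiv (eigenpoly k)) / h k)
      = (\<Sum>k\<in>I. 2 * eigval k * (real k + lam) / (2 * lam + 1))"
    using less_imp_neq[OF h, symmetric] by (simp add: L_pderiv_eigenpoly_square flip: h_def)
  finally show ?thesis by (simp add: mult.commute)
qed

text \<open>With A = k and B = k + 2 lam, each summand is ((A+1)(B+1))^2 - ((A-1)(B-1))^2 minus a
  positive term. For steps of two in k the differences of squares telescope.\<close>

lemma trace_same_parity:
  assumes "even (n + s)"
  shows "8 * (\<Sum>k\<in>{k. k \<le> n \<and> even (k + s)}. eigval k * (real k + lam))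
    < ((real n + 1) * (real n + 2 * lam + 1))\<^sup>2"
  using assms
proof (induction n rule: nat_induct2)
  case 0
  have "{k::nat. k \<le> 0 \<and> even (k + s)} = {0}" using 0 by auto
  then show ?case using lam by (simp add: eigval_def)
next
  case 1
  have "{k::nat. k \<le> 1 \<and> even (k + s)} = {1}" using 1 by (auto simp: le_Suc_eq)
  moreover have "8 * ((1 + 2 * lam) * (1 + lam)) < (2 * (2 + 2 * lam))\<^sup>2"
  proof -
    have "(1 + lam) * (1 + 2 * lam) < (1 + lam) * (2 + 2 * lam)"
      using lam by (intro mult_strict_left_mono) auto
    then show ?thesis by (simp add: power2_eq_square algebra_simps)
  qed
  ultimately show ?case by (simp add: eigval_def algebra_simps)
next
  case (step n)
  let ?A = "real (n + 2)" and ?B = "real (n + 2) + 2 * lam"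
  have "{k. k \<le> n + 2 \<and> even (k + s)} = insert (n + 2) {k. k \<le> n \<and> even (k + s)}"
    using step.prems by (auto simp: le_Suc_eq)
  then have "8 * (\<Sum>k\<in>{k. k \<le> n + 2 \<and> even (k + s)}. eigval k * (real k + lam))
      = 8 * (eigval (n + 2) * (?A + lam)) + 8 * (\<Sum>k\<in>{k. k \<le> n \<and> even (k + s)}. eigval k * (real k + lam))"
    by (simp only:) (subst sum.insert, auto)
  also have "\<dots> < 8 * (eigval (n + 2) * (?A + lam)) + ((real n + 1) * (real n + 2 * lam + 1))\<^sup>2"
    using step by simp
  also have "8 * (eigval (n + 2) * (?A + lam)) = ((?A + 1) * (?B + 1))\<^sup>2 - ((?A - 1) * (?B - 1))\<^sup>2 - 8 * (?A + lam)"
    unfolding eigval_def by (simp add: power2_eq_square algebra_simps)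
  also have "8 * (?A + lam) > 0" using lam by simp
  then have "((?A + 1) * (?B + 1))\<^sup>2 - ((?A - 1) * (?B - 1))\<^sup>2 - 8 * (?A + lam)
      + ((real n + 1) * (real n + 2 * lam + 1))\<^sup>2 \<le> ((?A + 1) * (?B + 1))\<^sup>2"
    by (simp add: algebra_simps)
  finally show ?case by (simp add: algebra_simps)
qed

text \<open>If \<open>n\<close> has the other parity, the sum ends at \<open>n - 1\<close>, and the
  bound is monotone in \<open>n\<close>.\<close>

lemma trace_parity:
  assumes "n \<ge> 1"
  shows "8 * (\<Sum>k\<in>{k. k \<le> n \<and> even (k + s)}. eigval k * (real k + lam))
    < ((real n + 1) * (real n + 2 * lam + 1))\<^sup>2"
proof (cases "even (n + s)")
  case True
  then show ?thesis by (rule trace_same_parity)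
next
  case False
  have eq: "{k. k \<le> n \<and> even (k + s)} = {k. k \<le> n - 1 \<and> even (k + s)}"
    using False by (auto simp: le_less)
  have "8 * (\<Sum>k\<in>{k. k \<le> n \<and> even (k + s)}. eigval k * (real k + lam))
    < ((real (n - 1) + 1) * (real (n - 1) + 2 * lam + 1))\<^sup>2"
    unfolding eq using False assms by (intro trace_same_parity) auto
  also have "\<dots> \<le> ((real n + 1) * (real n + 2 * lam + 1))\<^sup>2"
    using lam by (intro power_mono mult_mono mult_nonneg_nonneg) auto
  finally show ?thesis .
qed

text \<open>One \<open>K\<close> strictly below the squared bound serves all \<open>f\<close>, so
  strictness survives the supremum. It is the larger of the two parity traces.\<close>

lemma real_markov:
  assumes "n \<ge> 1"
  obtains K where "K < ((real n + 1) * (real n + 2 * lam + 1) / (2 * sqrt (2 * lam + 1)))\<^sup>2"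
    and "\<And>f. degree f \<le> n \<Longrightarrow> L (pderiv f * pderiv f) \<le> K * L (f * f)"
proof -
  define I where "I s = {k. k \<le> n \<and> even (k + s)}" for s
  define C where "C s = (\<Sum>k\<in>I s. 2 * eigval k * (real k + lam) / (2 * lam + 1))" for s
  let ?B = "(real n + 1) * (real n + 2 * lam + 1)"
  have fin: "finite (I s)" for s
    by (simp add: I_def)
  have C: "C s < (?B / (2 * sqrt (2 * lam + 1)))\<^sup>2" for s
  proof -
    have "C s = 8 * (\<Sum>k\<in>I s. eigval k * (real k + lam)) / (4 * (2 * lam + 1))"
      unfolding C_def sum_distrib_left sum_divide_distrib
      by (rule sum.cong) (use lam in \<open>simp_all add: field_simps\<close>)
    also have "\<dots> < ?B\<^sup>2 / (4 * (2 * lam + 1))"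
      using trace_parity[OF assms, of s] lam unfolding I_def by (intro divide_strict_right_mono) auto
    also have "\<dots> = (?B / (2 * sqrt (2 * lam + 1)))\<^sup>2"
      using lam by (simp add: power_divide power_mult_distrib)
    finally show ?thesis .
  qed
  show ?thesis
  proof (rule that)
    show "max (C 0) (C 1) < (?B / (2 * sqrt (2 * lam + 1)))\<^sup>2"
      using C by simp
    fix f :: "real poly" assume "degree f \<le> n"
    then have "coeff f i = 0" if "i \<ge> Suc n" for i
      using that by (intro coeff_eq_0) auto
    then obtain a where a: "f = (\<Sum>j<Suc n. smult (a j) (eigenpoly j))"
      using eigenpoly_expansion by blast
    define g where "g s = (\<Sum>k\<in>I s. smult (a k) (eigenpoly k))" for s
    have "{..<Suc n} = I 0 \<union> I 1" "I 0 \<inter> I 1 = {}"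
      by (auto simp: I_def)
    then have f: "f = g 0 + g 1"
      unfolding a g_def using fin by (simp add: sum.union_disjoint)
    have g: "parity_poly s (g s)" for s
      unfolding g_def
    proof (rule parity_poly_sum)
      fix k assume "k \<in> I s"
      then have "even k = even s" by (simp add: I_def)
      then show "parity_poly s (smult (a k) (eigenpoly k))"
        using parity_eigenpoly[of k] by (simp add: parity_poly_def)
    qed
    \<comment> \<open>Even times odd is odd, and differentiation swaps the two classes, so the cross
      terms vanish both for \<open>f\<close> and for its derivative.\<close>
    have 0: "L (g 0 * g 1) = 0"
      using parity_poly_mult[OF g[of 0] g[of 1]] by (rule L_odd) simp
    have 1: "L (pderiv (g 0) * pderiv (g 1)) = 0"
      using parity_poly_mult[OF g[THEN parity_poly_pderiv, of 0] g[THEN parity_poly_pderiv, of 1]]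
      by (rule L_odd) simp
    have pythagoras: "L ((p + q) * (p + q)) = L (p * p) + L (q * q)" if "L (p * q) = 0" for p q
      using that by (simp only: ring_distribs L_add mult.commute[of q p])
    have "L (pderiv (g s) * pderiv (g s)) \<le> max (C 0) (C 1) * L (g s * g s)" if "s \<in> {0, 1}" for s
    proof -
      have "L (pderiv (g s) * pderiv (g s)) \<le> C s * L (g s * g s)"
        unfolding C_def using fin g_def by (rule pderiv_bound_from_trace)
      also have "L (g s * g s) \<ge> 0"
        using L_square_pos[of "g s"] by (cases "g s = 0") auto
      then have "C s * L (g s * g s) \<le> max (C 0) (C 1) * L (g s * g s)"
        using that by (intro mult_right_mono) auto
      finally show ?thesis .
    qed
    from this[of 0] this[of 1] show "L (pderiv f * pderiv f) \<le> max (C 0) (C 1) * L (f * f)"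
      unfolding f pderiv_add pythagoras[OF 0] pythagoras[OF 1] by (simp add: ring_distribs)
  qed
qed

section \<open>From real to complex polynomials\<close>

lemma gegenbauer_norm_Re_Im:
  "gegenbauer_norm lam f
    = sqrt (L (map_poly Re f * map_poly Re f) + L (map_poly Im f * map_poly Im f))"
proof -
  have "poly (map_poly Re f) t = Re (poly f (complex_of_real t)) \<and>
        poly (map_poly Im f) t = Im (poly f (complex_of_real t))" for t
    by (induction f) (auto simp: map_poly_pCons)
  then have "(cmod (poly f (complex_of_real t)))\<^sup>2
      = poly (map_poly Re f * map_poly Re f + map_poly Im f * map_poly Im f) t" for t
    by (simp add: cmod_power2 flip: power2_eq_square)
  then show ?thesis
    unfolding gegenbauer_norm_def gegenbauer_int_def[symmetric] L_add[symmetric]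
    by (simp only: gegenbauer_int_def)
qed

end

lemma pderiv_map_poly_Re: "pderiv (map_poly Re f) = map_poly Re (pderiv f)"
  by (simp add: poly_eq_iff coeff_pderiv coeff_map_poly)

lemma pderiv_map_poly_Im: "pderiv (map_poly Im f) = map_poly Im (pderiv f)"
  by (simp add: poly_eq_iff coeff_pderiv coeff_map_poly)

theorem theorem1p1:
  fixes lam :: real and n :: nat
  assumes "lam > -1/2" and "n \<ge> 1"
  shows "markov_const n lam <
           ereal ((real n + 1) * (real n + 2 * lam + 1) / (2 * sqrt (2 * lam + 1)))"
proof -
  interpret gegenbauer lam by unfold_locales (fact assms(1))
  let ?B = "(real n + 1) * (real n + 2 * lam + 1) / (2 * sqrt (2 * lam + 1))"
  obtain K where K: "K < ?B\<^sup>2" "\<And>f. degree f \<le> n \<Longrightarrow> L (pderiv f * pderiv f) \<le> K * L (f * f)"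
    using real_markov[OF assms(2)] by blast
  have "gegenbauer_norm lam (pderiv f) / gegenbauer_norm lam f \<le> sqrt K"
    if "degree f \<le> n" "f \<noteq> 0" for f
  proof -
    let ?u = "map_poly Re f" and ?v = "map_poly Im f"
    let ?N = "L (?u * ?u) + L (?v * ?v)"
    have "degree ?u \<le> n" "degree ?v \<le> n"
      using that(1) by (auto intro!: degree_le simp: coeff_map_poly coeff_eq_0)
    then have "gegenbauer_norm lam (pderiv f) \<le> sqrt (K * ?N)"
      unfolding gegenbauer_norm_Re_Im pderiv_map_poly_Re[symmetric] pderiv_map_poly_Im[symmetric]
      by (auto simp: ring_distribs intro!: add_mono K(2))
    \<comment> \<open>The real \<open>sqrt\<close> is multiplicative on all reals, so the sign of
      \<open>K\<close> need not be discussed.\<close>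
    then have *: "gegenbauer_norm lam (pderiv f) \<le> sqrt K * gegenbauer_norm lam f"
      unfolding gegenbauer_norm_Re_Im[of f] by (simp add: real_sqrt_mult)
    have "?u \<noteq> 0 \<or> ?v \<noteq> 0"
      using that(2) by (auto simp: poly_eq_iff coeff_map_poly complex_eq_iff)
    moreover have "L (p * p) \<ge> 0" for p
      using L_square_pos[of p] by (cases "p = 0") auto
    ultimately have "?N > 0"
      using L_square_pos[of ?u] L_square_pos[of ?v] by (meson add_nonneg_pos add_pos_nonneg)
    then have "gegenbauer_norm lam f > 0"
      unfolding gegenbauer_norm_Re_Im by simp
    with * show ?thesis by (simp add: divide_le_eq)
  qed
  then have "markov_const n lam \<le> ereal (sqrt K)"
    unfolding markov_const_def by (intro SUP_least) auto
  also have "sqrt K < ?B"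
    using K(1) assms(1) by (intro real_less_lsqrt) auto
  then have "ereal (sqrt K) < ereal ?B" by simp
  finally show ?thesis .
qed

end
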